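(* Let $n\ge1$, and let $U(R)$ and $U(\overline R)$ be the algebras defined in the context. In $U(R)$ we have $$D L^{\pm}(u\xi)^{\mathrm t}D^{-1}L^{\pm}(u)=L^{\pm}(u)DL^{\pm}(u\xi)^{\mathrm t}D^{-1}=z^{\pm}(u)\,1,$$ and in $U(\overline R)$ we have $$D\mathcal L^{\pm}(u\xi)^{\mathrm t}D^{-1}\mathcal L^{\pm}(u)=\mathcal L^{\pm}(u)D\mathcal L^{\pm}(u\xi)^{\mathrm t}D^{-1}=\mathfrak z^{\pm}(u)\,1,$$ for certain series $z^\pm(u)$ and $\mathfrak z^\pm(u)$ with coefficients in the respective algebra, where $1$ is the identity matrix.
   Context: $q$ is a variable and algebras are over $\mathbb C(q)$. For $1\le i\le 2n$ put $i'=2n+1-i$; $\varepsilon_i=1$ for $i\le n$ and $-1$ for $i>n$; $(\bar1,\dots,\overline{2n})=(n,\dots,1,-1,\dots,-n)$; $e_{ij}\in\mathrm{End}\,\mathbb C^{2n}$ are matrix units; $\xi=q^{-2n-2}$. Set $P=\sum_{i,j}e_{ij}\otimes e_{ji}$, $Q=\sum_{i,j}q^{\bar i-\bar j}\varepsilon_i\varepsilon_je_{i'j'}\otimes e_{ij}$, $$R=q\sum_ie_{ii}\otimes e_{ii}+\sum_{i\ne j,j'}e_{ii}\otimes e_{jj}+q^{-1}\sum_{i}e_{ii}\otimes e_{i'i'}+(q-q^{-1})\sum_{i<j}e_{ij}\otimes e_{ji}-(q-q^{-1})\sum_{i>j}q^{\bar i-\bar j}\varepsilon_i\varepsilon_je_{i'j'}\otimes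 e_{ij},$$ $$\overline R(u)=\frac{u-1}{uq-q^{-1}}R+\frac{q-q^{-1}}{uq-q^{-1}}P-\frac{(q-q^{-1})(u-1)\xi}{(uq-q^{-1})(u-\xi)}Q,\qquad R(u)=g(u)\overline R(u),\quad g(u)=f(u)(u-q^{-2})(u-\xi),$$ where $f(u)=1+\sum_{k\ge1}f_ku^k$, $f_k\in\mathbb C(q)$, is the unique series with $f(u)f(u\xi)=\big((1-uq^{-2})(1-uq^2)(1-u\xi)(1-u\xi^{-1})\big)^{-1}$. The algebra $U(R)$ is generated by an invertible central element $q^{c/2}$ and elements $l^\pm_{ij}[\mp m]$ ($1\le i,j\le 2n$, $m\ge0$). Put $l^\pm_{ij}(u)=\sum_{m\ge0}l^\pm_{ij}[\mp m]u^{\pm m}$, $L^\pm(u)=\sum e_{ij}\otimes l^\pm_{ij}(u)$, $L_1^\pm(u)=\sum e_{ij}\otimes1\otimes l^\pm_{ij}(u)$, $L_2^\pm(u)=\sum1\otimes e_{ij}\otimes l^\pm_{ij}(u)$. Relations: $l^+_{ij}[0]=l^-_{ji}[0]=0$ for $i<j$; $l^+_{nn}[0]l^+_{n+1,n+1}[0]=1$; $l^+_{ii}[0]l^-_{ii}[0]=l^-_{ii}[0]l^+_{ii}[0]=1$; $$R(u/v)L^\pm_1(u)L^\pm_2(v)=L_2^\pm(v)L_1^\pm(u)R(u/v),\qquad R(uq^c/v)L^+_1(u)L^-_2(v)=L^-_2(v)L^+_1(u)R(uq^{-c}/v).$$ The algebra $U(\overline R)$ is defined in the same way, with generators denoted $\ell^\pm_{ij}[\mp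 m]$, series $\ell_{ij}^\pm(u)$ and matrices $\mathcal L^\pm(u)$, and with $R$ replaced by $\overline R$ in the relations (in the mixed relation, rational functions are expanded in nonnegative powers of $u/v$). $\mathrm t$ is the matrix transposition $e_{ij}^{\mathrm t}=\varepsilon_i\varepsilon_je_{j'i'}$, and $D=\mathrm{diag}[q^n,\dots,q,q^{-1},\dots,q^{-n}]$. *)

theory Defs
  imports
    "HOL-Analysis.Cartesian_Space"
    "HOL-Computational_Algebra.Polynomial"
    "HOL-Computational_Algebra.Formal_Power_Series"
    "HOL-Computational_Algebra.Fraction_Field"
    "HOL-Library.Poly_Mapping"
begin

section \<open>Scalars and free algebras\<close>

type_synonym Cq = "complex poly fract"

definition q :: Cq where "q = Fract [:0, 1:] 1"

lemma q_power: "q ^ k = Fract (monom 1 k) 1"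
  by (induction k)
     (simp_all add: q_def One_fract_def monom_altdef numeral_poly one_pCons)

lemma q_neq_0: "q \<noteq> 0"
  by (simp add: q_def Zero_fract_def eq_fract)

lemma q_power_plus_one_neq_0: "q ^ k + 1 \<noteq> 0"
proof -
  have "poly (monom (1::complex) k + 1) 1 \<noteq> 0"
    by (simp add: poly_monom)
  hence "monom (1::complex) k + 1 \<noteq> 0" by force
  thus ?thesis by (simp add: q_power One_fract_def Zero_fract_def eq_fract)
qed

datatype 'g word = Word (letters: "'g list")

instantiation word :: (type) monoid_add
begin
definition zero_word :: "'a word" where "0 = Word []"
definition plus_word :: "'a word \<Rightarrow> 'a word \<Rightarrow> 'a word"
  where "v + w = Word (letters v @ letters w)"
instance by standard (auto simp: zero_word_def plus_word_def)
end

text \<open>The free unital associative algebra on the set of all elements of type \<^typ>\<open>'g\<close>: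
  the monoid algebra (with convolution product) of the monoid of words.\<close>
type_synonym 'g falg = "'g word \<Rightarrow>\<^sub>0 Cq"

definition scal :: "Cq \<Rightarrow> 'g falg" where "scal a = Poly_Mapping.single 0 a"
definition var :: "'g \<Rightarrow> 'g falg" where "var g = Poly_Mapping.single (Word [g]) 1"

inductive_set two_sided_ideal :: "'a::ring_1 set \<Rightarrow> 'a set" for S where
  zero: "0 \<in> two_sided_ideal S"
| base: "s \<in> S \<Longrightarrow> a * s * b \<in> two_sided_ideal S"
| add: "x \<in> two_sided_ideal S \<Longrightarrow> y \<in> two_sided_ideal S \<Longrightarrow> x + y \<in> two_sided_ideal S"

lemma two_sided_ideal_mult:
  "x \<in> two_sided_ideal S \<Longrightarrow> a * x * b \<in> two_sided_ideal S"
proof (induction rule: two_sided_ideal.induct)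
  case (base s c d)
  have "a * (c * s * d) * b = (a * c) * s * (d * b)" by (simp add: mult.assoc)
  then show ?case using base by (metis two_sided_ideal.base)
qed (auto simp: distrib_left distrib_right intro: two_sided_ideal.intros)

lemma two_sided_ideal_mult_left:
  "x \<in> two_sided_ideal S \<Longrightarrow> a * x \<in> two_sided_ideal S"
  using two_sided_ideal_mult[of x S a 1] by simp

lemma two_sided_ideal_mult_right:
  "x \<in> two_sided_ideal S \<Longrightarrow> x * b \<in> two_sided_ideal S"
  using two_sided_ideal_mult[of x S 1 b] by simp

lemma two_sided_ideal_uminus:
  "x \<in> two_sided_ideal S \<Longrightarrow> - x \<in> two_sided_ideal S"
  using two_sided_ideal_mult_left[of x S "- 1"] by simp

lemma two_sided_ideal_diff:
  "x \<in> two_sided_ideal S \<Longrightarrow> y \<in> two_sided_ideal S \<Longrightarrow> x - y \<in> two_sided_ideal S"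
  using two_sided_ideal.add[of x S "- y"] two_sided_ideal_uminus[of y S] by simp

section \<open>Algebras given by generators and relations\<close>

text \<open>The relation \<open>x = y\<close> is encoded by the relator \<open>x - y\<close>. The axiom of the class only says
  that the presented algebra is not the zero ring, as \<^class>\<open>ring_1\<close> demands.\<close>
class presented =
  fixes relators :: "'a falg set"
  assumes one_notin_ideal: "1 \<notin> two_sided_ideal relators"

quotient_type (overloaded) 'g presented_algebra = "'g::presented falg"
  / "\<lambda>x y. x - y \<in> two_sided_ideal relators"
proof (rule equivpI)
  show "reflp (\<lambda>x y. x - y \<in> two_sided_ideal (relators :: 'g falg set))"
    by (auto intro!: reflpI two_sided_ideal.zero)
  show "symp (\<lambda>x y. x - y \<in> two_sided_ideal (relators :: 'g falg set))"
    using two_sided_ideal_uminus by (fastforce intro!: sympI)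
  show "transp (\<lambda>x y. x - y \<in> two_sided_ideal (relators :: 'g falg set))"
    using two_sided_ideal.add by (fastforce intro!: transpI)
qed

instantiation presented_algebra :: (presented) ring_1
begin

lift_definition zero_presented_algebra :: "'a presented_algebra" is 0 .
lift_definition one_presented_algebra :: "'a presented_algebra" is 1 .

lift_definition plus_presented_algebra ::
  "'a presented_algebra \<Rightarrow> 'a presented_algebra \<Rightarrow> 'a presented_algebra" is "(+)"
  by (metis add_diff_add two_sided_ideal.add)

lift_definition minus_presented_algebra ::
  "'a presented_algebra \<Rightarrow> 'a presented_algebra \<Rightarrow> 'a presented_algebra" is "(-)"
proof -
  fix a b c d :: "'a falg"
  assume "a - b \<in> two_sided_ideal relators" "c - d \<in> two_sided_ideal relators"
  from two_sided_ideal_diff[OF this]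
  show "(a - c) - (b - d) \<in> two_sided_ideal relators" by (simp add: algebra_simps)
qed

lift_definition uminus_presented_algebra ::
  "'a presented_algebra \<Rightarrow> 'a presented_algebra" is "uminus"
  using two_sided_ideal_uminus by fastforce

lift_definition times_presented_algebra ::
  "'a presented_algebra \<Rightarrow> 'a presented_algebra \<Rightarrow> 'a presented_algebra" is "(*)"
proof -
  fix a b c d :: "'a falg"
  assume ab: "a - b \<in> two_sided_ideal relators" and cd: "c - d \<in> two_sided_ideal relators"
  have "(a - b) * c + b * (c - d) \<in> two_sided_ideal relators"
    by (intro two_sided_ideal.add two_sided_ideal_mult_left two_sided_ideal_mult_right ab cd)
  then show "a * c - b * d \<in> two_sided_ideal relators" by (simp add: algebra_simps)
qed

instance
proof
  show "(0 :: 'a presented_algebra) \<noteq> 1"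
    by transfer (metis minus_diff_eq diff_0_right one_notin_ideal two_sided_ideal_uminus)
qed (transfer; simp add: algebra_simps two_sided_ideal.zero)+

end

definition quot_map :: "'g::presented falg \<Rightarrow> 'g presented_algebra"
  where "quot_map = abs_presented_algebra"

lemma quot_map_eq_iff:
  "quot_map x = quot_map y \<longleftrightarrow> x - y \<in> two_sided_ideal relators"
  by (simp add: quot_map_def presented_algebra.abs_eq_iff)

lemma quot_map_hom:
  "quot_map 0 = 0" "quot_map 1 = 1" "quot_map (x + y) = quot_map x + quot_map y"
  "quot_map (x - y) = quot_map x - quot_map y" "quot_map (- x) = - quot_map x"
  "quot_map (x * y) = quot_map x * quot_map y"
  by (simp_all add: quot_map_def zero_presented_algebra_def one_presented_algebra_def
      plus_presented_algebra.abs_eq minus_presented_algebra.abs_eq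
      uminus_presented_algebra.abs_eq times_presented_algebra.abs_eq)

definition of_Cq :: "Cq \<Rightarrow> 'g::presented presented_algebra" where "of_Cq a = quot_map (scal a)"
definition gen :: "'g \<Rightarrow> 'g::presented presented_algebra" where "gen g = quot_map (var g)"

section \<open>Indices\<close>

text \<open>The integer \<open>n\<close> is \<^term>\<open>CARD('n)\<close>.\<close>
typedef (overloaded) ('n::finite) idx = "{1..2 * CARD('n)}"
  morphisms num mk_idx
  by (intro exI[of _ 1]) simp

instance idx :: (finite) finite
proof
  have "finite (num ` (UNIV :: 'a idx set))"
    by (rule finite_subset[of _ "{1..2 * CARD('a)}"]) (use num[where ?'n = 'a] in auto)
  then show "finite (UNIV :: 'a idx set)"
    by (rule finite_imageD) (simp add: inj_on_def num_inject)
qed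

definition dual_idx :: "'n::finite idx \<Rightarrow> 'n idx"  ("_\<^sup>*" [1000] 999)
  where "i\<^sup>* = mk_idx (2 * CARD('n) + 1 - num i)"

definition eps :: "'n::finite idx \<Rightarrow> int"
  where "eps i = (if num i \<le> CARD('n) then 1 else - 1)"

definition bar :: "'n::finite idx \<Rightarrow> int"
  where "bar i = (if num i \<le> CARD('n) then int CARD('n) + 1 - int (num i)
                  else int CARD('n) - int (num i))"

section \<open>R-matrices\<close>

text \<open>An element of \<open>End V \<otimes> End V\<close> tensored with a ring is given by its array of coefficients:
  its value at \<open>a b c d\<close> is the coefficient of \<open>e\<^bsub>ab\<^esub> \<otimes> e\<^bsub>cd\<^esub>\<close>. The element
  \<open>e\<^bsub>ij\<^esub> \<otimes> e\<^bsub>kl\<^esub>\<close> itself is \<open>E i j k l\<close>.\<close>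
type_synonym ('n, 'a) tensor2 = "'n idx \<Rightarrow> 'n idx \<Rightarrow> 'n idx \<Rightarrow> 'n idx \<Rightarrow> 'a"

definition E :: "'n::finite idx \<Rightarrow> 'n idx \<Rightarrow> 'n idx \<Rightarrow> 'n idx \<Rightarrow> ('n, Cq) tensor2"
  where "E i j k l a b c d = of_bool (a = i \<and> b = j \<and> c = k \<and> d = l)"

definition xi :: "'n::finite itself \<Rightarrow> Cq"
  where "xi _ = q powi (- 2 * int CARD('n) - 2)"

definition Pmat :: "('n::finite, Cq) tensor2"
  where "Pmat a b c d = (\<Sum>i\<in>UNIV. \<Sum>j\<in>UNIV. E i j j i a b c d)"

definition Qmat :: "('n::finite, Cq) tensor2"
  where "Qmat a b c d = (\<Sum>i\<in>UNIV. \<Sum>j\<in>UNIV.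
    q powi (bar i - bar j) * of_int (eps i * eps j) * E (i\<^sup>*) (j\<^sup>*) i j a b c d)"

definition Rconst :: "('n::finite, Cq) tensor2"
  where "Rconst a b c d =
     q * (\<Sum>i\<in>UNIV. E i i i i a b c d)
   + (\<Sum>i\<in>UNIV. \<Sum>j | i \<noteq> j \<and> i \<noteq> j\<^sup>*. E i i j j a b c d)
   + inverse q * (\<Sum>i\<in>UNIV. E i i (i\<^sup>*) (i\<^sup>*) a b c d)
   + (q - inverse q) * (\<Sum>i\<in>UNIV. \<Sum>j | num i < num j. E i j j i a b c d)
   - (q - inverse q) * (\<Sum>i\<in>UNIV. \<Sum>j | num i > num j.
       q powi (bar i - bar j) * of_int (eps i * eps j) * E (i\<^sup>*) (j\<^sup>*) i j a b c d)"

text \<open>Rational functions of the spectral parameter \<^term>\<open>fps_X\<close> are expanded in its nonnegative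
  powers; the denominators have a nonzero constant term. In the relations between series of equal
  signs this is the same as clearing denominators, since the expanded inverses are units.\<close>
definition Rbar :: "('n::finite, Cq fps) tensor2"
  where "Rbar a b c d =
   (let u = fps_X; K = fps_const; \<xi> = xi TYPE('n) in
     (u - 1) * inverse (u * K q - K (inverse q)) * K (Rconst a b c d)
   + K (q - inverse q) * inverse (u * K q - K (inverse q)) * K (Pmat a b c d)
   - K (q - inverse q) * (u - 1) * K \<xi> * inverse ((u * K q - K (inverse q)) * (u - K \<xi>))
       * K (Qmat a b c d))"

definition is_normalizer :: "'n::finite itself \<Rightarrow> Cq fps \<Rightarrow> bool"
  where "is_normalizer _ f \<longleftrightarrow>
   (let u = fps_X; K = fps_const; \<xi> = xi TYPE('n) in
     fps_nth f 0 = 1 \<and>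
     f * (f oo (u * K \<xi>)) =
       inverse ((1 - u * K (q powi (- 2))) * (1 - u * K (q ^ 2)) * (1 - u * K \<xi>)
                * (1 - u * K (inverse \<xi>))))"

lemma normalizer_coeff_eq:
  fixes f h :: "Cq fps"
  assumes "fps_nth f 0 = 1"
  shows "f * (f oo (fps_X * fps_const \<xi>)) = h \<longleftrightarrow>
    fps_nth h 0 = 1 \<and> (\<forall>n>0. (1 + \<xi> ^ n) * fps_nth f n
      + (\<Sum>i\<in>{1..<n}. fps_nth f i * (\<xi> ^ (n - i) * fps_nth f (n - i))) = fps_nth h n)"
proof -
  have eq: "f oo (fps_X * fps_const \<xi>) = Abs_fps (\<lambda>n. \<xi> ^ n * fps_nth f n)"
    by (subst mult.commute) (rule fps_compose_linear)
  have coeff: "fps_nth (f * (f oo (fps_X * fps_const \<xi>))) n =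
      (1 + \<xi> ^ n) * fps_nth f n
      + (\<Sum>i\<in>{1..<n}. fps_nth f i * (\<xi> ^ (n - i) * fps_nth f (n - i)))" if "n > 0" for n
  proof -
    have "{0..n} = insert 0 (insert n {1..<n})" using that by auto
    then show ?thesis using that assms by (simp add: eq fps_mult_nth algebra_simps)
  qed
  have "fps_nth (f * (f oo (fps_X * fps_const \<xi>))) 0 = 1"
    using assms by (simp add: fps_mult_nth)
  moreover have "f * (f oo (fps_X * fps_const \<xi>)) = h \<longleftrightarrow>
      fps_nth (f * (f oo (fps_X * fps_const \<xi>))) 0 = fps_nth h 0 \<and>
      (\<forall>n>0. fps_nth (f * (f oo (fps_X * fps_const \<xi>))) n = fps_nth h n)"
    unfolding fps_eq_iff using neq0_conv by blast
  ultimately show ?thesis using coeff by (simp only: eq_commute[of _ "1 :: Cq"]) simp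
qed

function normalizer_coeff :: "Cq \<Rightarrow> Cq fps \<Rightarrow> nat \<Rightarrow> Cq" where
  "normalizer_coeff \<xi> h n = (if n = 0 then 1 else
     (fps_nth h n - (\<Sum>i\<in>{1..<n}. normalizer_coeff \<xi> h i
        * (\<xi> ^ (n - i) * normalizer_coeff \<xi> h (n - i)))) / (1 + \<xi> ^ n))"
  by auto
termination by (relation "measure (\<lambda>(_, _, n). n)") auto
declare normalizer_coeff.simps [simp del]

lemma ex1_normalizer_general:
  fixes h :: "Cq fps"
  assumes h: "fps_nth h 0 = 1" and \<xi>: "\<And>n. 1 + \<xi> ^ n \<noteq> 0"
  shows "\<exists>!f. fps_nth f 0 = 1 \<and> f * (f oo (fps_X * fps_const \<xi>)) = h"
proof (rule ex_ex1I)
  let ?f = "Abs_fps (normalizer_coeff \<xi> h)"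
  have 0: "fps_nth ?f 0 = 1" by (simp add: normalizer_coeff.simps)
  have "(1 + \<xi> ^ n) * normalizer_coeff \<xi> h n = fps_nth h n - (\<Sum>i\<in>{1..<n}.
      normalizer_coeff \<xi> h i * (\<xi> ^ (n - i) * normalizer_coeff \<xi> h (n - i)))" if "n > 0" for n
    using that \<xi>[of n] by (subst normalizer_coeff.simps) simp
  then have "?f * (?f oo (fps_X * fps_const \<xi>)) = h"
    unfolding normalizer_coeff_eq[OF 0] using h by simp
  with 0 show "\<exists>f. fps_nth f 0 = 1 \<and> f * (f oo (fps_X * fps_const \<xi>)) = h" by blast
next
  fix f g :: "Cq fps"
  assume f: "fps_nth f 0 = 1 \<and> f * (f oo (fps_X * fps_const \<xi>)) = h"
    and g: "fps_nth g 0 = 1 \<and> g * (g oo (fps_X * fps_const \<xi>)) = h"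
  have "fps_nth f n = fps_nth g n" for n
  proof (induction n rule: less_induct)
    case (less n)
    show ?case
    proof (cases "n = 0")
      case False
      define S where "S = (\<Sum>i\<in>{1..<n}. fps_nth g i * (\<xi> ^ (n - i) * fps_nth g (n - i)))"
      have "(\<Sum>i\<in>{1..<n}. fps_nth f i * (\<xi> ^ (n - i) * fps_nth f (n - i))) = S"
        unfolding S_def by (intro sum.cong) (auto simp: less)
      then have "(1 + \<xi> ^ n) * fps_nth f n + S = fps_nth h n"
        using f False normalizer_coeff_eq[of f \<xi> h] by auto
      moreover have "(1 + \<xi> ^ n) * fps_nth g n + S = fps_nth h n"
        unfolding S_def using g False normalizer_coeff_eq[of g \<xi> h] by auto
      ultimately have "(1 + \<xi> ^ n) * fps_nth f n = (1 + \<xi> ^ n) * fps_nth g n"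
        by (simp only: eq_diff_eq[symmetric])
      then show ?thesis using \<xi>[of n] by simp
    qed (use f g in simp)
  qed
  then show "f = g" by (simp add: fps_eq_iff)
qed

lemma ex1_normalizer: "\<exists>!f. is_normalizer (t :: 'n::finite itself) f"
proof -
  have "1 + xi t ^ k \<noteq> 0" for k
  proof -
    have "- 2 * int CARD('n) - 2 = - int (2 * CARD('n) + 2)" by simp
    moreover define N where "N = 2 * CARD('n) + 2"
    ultimately have "xi t = inverse (q ^ N)"
      by (simp only: xi_def power_int_minus power_int_of_nat)
    then have "xi t ^ k * (q ^ (N * k) + 1) = 1 + xi t ^ k"
      using q_neq_0 by (simp add: power_mult distrib_left power_inverse)
    moreover have "xi t ^ k \<noteq> 0" using q_neq_0 by (simp add: xi_def)
    then have "xi t ^ k * (q ^ (N * k) + 1) \<noteq> 0" using q_power_plus_one_neq_0[of "N * k"] by simp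
    ultimately show ?thesis by simp
  qed
  from ex1_normalizer_general[OF _ this, of "inverse ((1 - fps_X * fps_const (q powi (- 2)))
      * (1 - fps_X * fps_const (q ^ 2)) * (1 - fps_X * fps_const (xi t))
      * (1 - fps_X * fps_const (inverse (xi t))))"]
  show ?thesis by (simp add: is_normalizer_def Let_def xi_def)
qed

definition ffun :: "'n::finite itself \<Rightarrow> Cq fps"
  where "ffun t = (THE f. is_normalizer t f)"

definition gfun :: "'n::finite itself \<Rightarrow> Cq fps"
  where "gfun t = ffun t * (fps_X - fps_const (q powi (- 2))) * (fps_X - fps_const (xi t))"

definition Rmat :: "('n::finite, Cq fps) tensor2"
  where "Rmat a b c d = gfun TYPE('n) * Rbar a b c d"

section \<open>The algebras\<close>

datatype sign = Plus | Minus

text \<open>\<^term>\<open>Qc\<close> stands for \<open>q\<^bsup>c/2\<^esup>\<close> and \<^term>\<open>Qc_inv\<close> for its inverse; \<open>L Plus i j m\<close> and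
  \<open>L Minus i j m\<close> stand for the generators \<open>l\<^sup>+\<^bsub>ij\<^esub>[-m]\<close> and \<open>l\<^sup>-\<^bsub>ij\<^esub>[m]\<close>, the coefficients of
  \<open>u\<^bsup>m\<^esup>\<close> and \<open>u\<^bsup>-m\<^esup>\<close>.\<close>
datatype 'n genR = Qc | Qc_inv | L sign "('n::finite) idx" "'n idx" nat

text \<open>A second copy of the generating set, for the algebra defined by \<open>Rbar\<close> instead of
  \<open>Rmat\<close>; \<open>Bar (L s i j m)\<close> is the generator denoted by a script letter.\<close>
datatype 'n genRbar = Bar "('n::finite) genR"

text \<open>In the following, \<open>\<iota>\<close> embeds the names of the generators into the actual generating set.
  \<open>lcoeff \<iota> s i j k\<close> is the coefficient of \<open>u\<^bsup>k\<^esup>\<close>, \<open>k\<close> an integer, in \<open>l\<^bsup>s\<^esup>\<^bsub>ij\<^esub>(u)\<close>.\<close>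
definition lcoeff :: "('n::finite genR \<Rightarrow> 'g) \<Rightarrow> sign \<Rightarrow> 'n idx \<Rightarrow> 'n idx \<Rightarrow> int \<Rightarrow> 'g falg"
  where "lcoeff \<iota> s i j k = (case s of
     Plus \<Rightarrow> if k \<ge> 0 then var (\<iota> (L Plus i j (nat k))) else 0
   | Minus \<Rightarrow> if k \<le> 0 then var (\<iota> (L Minus i j (nat (- k)))) else 0)"

text \<open>The coefficient of \<open>e\<^bsub>ij\<^esub> \<otimes> e\<^bsub>kl\<^esub> u\<^bsup>s\<^esup> v\<^bsup>t\<^esup>\<close> in
  \<open>R(u\<kappa>/v) L\<^sub>1\<^bsup>\<sigma>\<^esup>(u) L\<^sub>2\<^bsup>\<tau>\<^esup>(v)\<close> and in \<open>L\<^sub>2\<^bsup>\<tau>\<^esup>(v) L\<^sub>1\<^bsup>\<sigma>\<^esup>(u) R(u\<kappa>/v)\<close>. The sums over the power \<open>m\<close>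
  of \<open>u/v\<close> have only finitely many nonzero terms for \<open>(\<sigma>, \<tau>)\<close> equal to \<open>(+, +)\<close>, \<open>(-, -)\<close>
  and \<open>(+, -)\<close>.\<close>
definition RLL :: "('n::finite genR \<Rightarrow> 'g) \<Rightarrow> ('n, Cq fps) tensor2 \<Rightarrow> 'g falg \<Rightarrow> sign \<Rightarrow> sign
    \<Rightarrow> 'n idx \<Rightarrow> 'n idx \<Rightarrow> 'n idx \<Rightarrow> 'n idx \<Rightarrow> int \<Rightarrow> int \<Rightarrow> 'g falg"
  where "RLL \<iota> R \<kappa> \<sigma> \<tau> i j k l s t =
    (\<Sum>a\<in>UNIV. \<Sum>b\<in>UNIV. Sum_any (\<lambda>m::nat.
       scal (fps_nth (R i a k b) m) * \<kappa> ^ m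
       * lcoeff \<iota> \<sigma> a j (s - int m) * lcoeff \<iota> \<tau> b l (t + int m)))"

definition LLR :: "('n::finite genR \<Rightarrow> 'g) \<Rightarrow> ('n, Cq fps) tensor2 \<Rightarrow> 'g falg \<Rightarrow> sign \<Rightarrow> sign
    \<Rightarrow> 'n idx \<Rightarrow> 'n idx \<Rightarrow> 'n idx \<Rightarrow> 'n idx \<Rightarrow> int \<Rightarrow> int \<Rightarrow> 'g falg"
  where "LLR \<iota> R \<kappa> \<sigma> \<tau> i j k l s t =
    (\<Sum>a\<in>UNIV. \<Sum>b\<in>UNIV. Sum_any (\<lambda>m::nat.
       lcoeff \<iota> \<tau> k b (t + int m) * lcoeff \<iota> \<sigma> i a (s - int m)
       * scal (fps_nth (R a j b l) m) * \<kappa> ^ m))"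

definition L_relators :: "('n::finite genR \<Rightarrow> 'g) \<Rightarrow> ('n, Cq fps) tensor2 \<Rightarrow> 'g falg set"
  where "L_relators \<iota> R =
   (let x = \<lambda>g. var (\<iota> g); l = \<lambda>s i j. x (L s i j 0);
        n = mk_idx CARD('n); n1 = mk_idx (CARD('n) + 1) in
     {x Qc * x Qc_inv - 1, x Qc_inv * x Qc - 1}
   \<union> {x Qc * x g - x g * x Qc | g. True}
   \<union> {l Plus i j | i j. num i < num j}
   \<union> {l Minus j i | i j. num i < num j}
   \<union> {l Plus n n * l Plus n1 n1 - 1}
   \<union> {l Plus i i * l Minus i i - 1 | i. True}
   \<union> {l Minus i i * l Plus i i - 1 | i. True}
   \<union> {RLL \<iota> R 1 \<sigma> \<sigma> i j k l s t - LLR \<iota> R 1 \<sigma> \<sigma> i j k l s t | \<sigma> i j k l s t. True}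
   \<union> {RLL \<iota> R (x Qc ^ 2) Plus Minus i j k l s t
       - LLR \<iota> R (x Qc_inv ^ 2) Plus Minus i j k l s t | i j k l s t. True})"

subsection \<open>The presented algebras are nonzero\<close>

text \<open>The assignment \<open>q\<^bsup>c/2\<^esup> \<mapsto> 1\<close>, \<open>L\<^sup>\<plusminus>(u) \<mapsto> 1\<close> satisfies all the relations.\<close>

definition feval :: "('g \<Rightarrow> Cq) \<Rightarrow> 'g falg \<Rightarrow> Cq"
  where "feval c x = (\<Sum>w\<in>Poly_Mapping.keys x. Poly_Mapping.lookup x w * prod_list (map c (letters w)))"

lemma feval_superset:
  assumes "finite A" "Poly_Mapping.keys x \<subseteq> A"
  shows "feval c x = (\<Sum>w\<in>A. Poly_Mapping.lookup x w * prod_list (map c (letters w)))"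
  unfolding feval_def using assms
  by (intro sum.mono_neutral_left) (auto simp: in_keys_iff)

lemma feval_add: "feval c (x + y) = feval c x + feval c y"
proof -
  have "Poly_Mapping.keys (x + y) \<subseteq> Poly_Mapping.keys x \<union> Poly_Mapping.keys y" by (rule Poly_Mapping.keys_add)
  then show ?thesis
    by (simp add: feval_superset[of "Poly_Mapping.keys x \<union> Poly_Mapping.keys y"] lookup_add distrib_right sum.distrib)
qed

lemma feval_0 [simp]: "feval c 0 = 0"
  by (simp add: feval_def)

lemma feval_single: "feval c (Poly_Mapping.single w a) = a * prod_list (map c (letters w))"
  by (subst feval_superset[of "{w}"]) auto

lemma feval_1 [simp]: "feval c 1 = 1"
  using feval_single[of c 0 1] by (simp add: zero_word_def flip: single_one)

lemma feval_uminus: "feval c (- x) = - feval c x"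
  using feval_add[of c x "- x"] by (simp add: eq_neg_iff_add_eq_0 add.commute)

lemma feval_diff: "feval c (x - y) = feval c x - feval c y"
  using feval_add[of c x "- y"] by (simp add: feval_uminus)

lemma falg_induct [case_names zero single add]:
  fixes x :: "'g falg"
  assumes "P 0" "\<And>w a. P (Poly_Mapping.single w a)" "\<And>x y. P x \<Longrightarrow> P y \<Longrightarrow> P (x + y)"
  shows "P x"
proof (induction x rule: update_induct)
  case const
  then show ?case using assms(1) .
next
  case (update f a b)
  have "Poly_Mapping.update a b f = f + Poly_Mapping.single a b"
    using update by (intro poly_mapping_eqI)
      (auto simp: lookup_update lookup_add lookup_single when_def in_keys_iff)
  then show ?case using update assms(2,3) by metis
qed

lemma feval_mult: "feval c (x * y) = feval c x * feval c y"
proof (induction x rule: falg_induct)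
  case (single w a)
  show ?case
    by (induction y rule: falg_induct)
       (simp_all add: feval_add distrib_left mult_single feval_single plus_word_def)
qed (simp_all add: feval_add distrib_right)

lemma feval_power: "feval c (x ^ k) = feval c x ^ k"
  by (induction k) (simp_all add: feval_mult)

lemma feval_sum: "feval c (sum f A) = (\<Sum>a\<in>A. feval c (f a))"
  by (induction A rule: infinite_finite_induct) (simp_all add: feval_add)

lemma feval_scal [simp]: "feval c (scal a) = a"
  by (simp add: scal_def feval_single zero_word_def)

lemma feval_var [simp]: "feval c (var g) = c g"
  by (simp add: var_def feval_single)

lemma one_notin_ideal_if_feval:
  assumes "\<And>r. r \<in> S \<Longrightarrow> feval c r = 0"
  shows "1 \<notin> two_sided_ideal S"
proof
  have "feval c x = 0" if "x \<in> two_sided_ideal S" for x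
    using that assms by induction (simp_all add: feval_add feval_mult)
  moreover assume "1 \<in> two_sided_ideal S"
  ultimately have "feval c (1 :: 'a falg) = 0" by blast
  then show False by simp
qed

fun triv :: "'n::finite genR \<Rightarrow> Cq" where
  "triv (L s i j m) = of_bool (i = j \<and> m = 0)"
| "triv g = 1"

lemma feval_Sum_any:
  assumes "finite {m. g m \<noteq> 0}"
  shows "feval c (Sum_any g) = Sum_any (\<lambda>m. feval c (g m))"
proof -
  have "{m. feval c (g m) \<noteq> 0} \<subseteq> {m. g m \<noteq> 0}" by auto
  with assms show ?thesis
    by (simp add: Sum_any.expand_superset[OF assms subset_refl]
        Sum_any.expand_superset[OF assms \<open>{m. feval c (g m) \<noteq> 0} \<subseteq> _\<close>] feval_sum)
qed

lemma finite_LL_support: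
  assumes "\<sigma> = Plus \<or> \<tau> = Minus"
  shows "finite {m::nat. lcoeff \<iota> \<sigma> a j (s - int m) \<noteq> 0 \<and> lcoeff \<iota>' \<tau> b l (t + int m) \<noteq> 0}"
    (is "finite ?A")
proof (rule finite_subset)
  show "?A \<subseteq> {..max (nat s) (nat (- t))}"
  proof
    fix m assume m: "m \<in> ?A"
    from assms show "m \<in> {..max (nat s) (nat (- t))}"
    proof
      assume "\<sigma> = Plus"
      with m have "0 \<le> s - int m" by (simp add: lcoeff_def split: if_splits)
      then show ?thesis by simp
    next
      assume "\<tau> = Minus"
      with m have "t + int m \<le> 0" by (simp add: lcoeff_def split: if_splits)
      then show ?thesis by simp
    qed
  qed
qed simp

lemma feval_lcoeff:
  assumes "\<And>g. c (\<iota> g) = triv g"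
  shows "feval c (lcoeff \<iota> s i j k) = of_bool (i = j \<and> k = 0)"
  by (cases s) (simp_all add: lcoeff_def assms)

lemma sum_UNIV_delta2:
  "(\<Sum>a\<in>UNIV. \<Sum>b\<in>UNIV. if P \<and> Q \<and> a = x \<and> b = y then c else 0) = (if P \<and> Q then c else 0)"
  for x :: "'a::finite" and y :: "'b::finite" and c :: "'c::comm_monoid_add"
proof -
  have "(if P \<and> Q \<and> a = x \<and> b = y then c else 0)
      = (if b = y then if a = x then if P \<and> Q then c else 0 else 0 else 0)" for a b
    by simp
  then show ?thesis by (simp only: sum.delta finite_class.finite_UNIV UNIV_I if_True)
qed

lemma feval_RLL:
  assumes c: "\<And>g. c (\<iota> g) = triv g" and \<kappa>: "feval c \<kappa> = 1" and st: "\<sigma> = Plus \<or> \<tau> = Minus"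
  shows "feval c (RLL \<iota> R \<kappa> \<sigma> \<tau> i j k l s t)
       = (if s \<ge> 0 \<and> t = - s then fps_nth (R i j k l) (nat s) else 0)"
proof -
  have *: "feval c (Sum_any (\<lambda>m::nat. scal (fps_nth (R i a k b) m) * \<kappa> ^ m
       * lcoeff \<iota> \<sigma> a j (s - int m) * lcoeff \<iota> \<tau> b l (t + int m)))
     = (if s \<ge> 0 \<and> t = - s \<and> a = j \<and> b = l then fps_nth (R i j k l) (nat s) else 0)" for a b
  proof -
    have "finite {m. scal (fps_nth (R i a k b) m) * \<kappa> ^ m
       * lcoeff \<iota> \<sigma> a j (s - int m) * lcoeff \<iota> \<tau> b l (t + int m) \<noteq> 0}"
      by (rule finite_subset[OF _ finite_LL_support[OF st, of \<iota> a j s \<iota> b l t]]) auto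
    then have "feval c (Sum_any (\<lambda>m::nat. scal (fps_nth (R i a k b) m) * \<kappa> ^ m
       * lcoeff \<iota> \<sigma> a j (s - int m) * lcoeff \<iota> \<tau> b l (t + int m)))
      = Sum_any (\<lambda>m. fps_nth (R i a k b) m
          * of_bool (a = j \<and> s - int m = 0) * of_bool (b = l \<and> t + int m = 0))"
      by (simp add: feval_Sum_any feval_mult feval_power \<kappa> feval_lcoeff[of c \<iota>, OF c])
    also have "\<dots> = (\<Sum>m\<in>{nat s}. fps_nth (R i a k b) m
          * of_bool (a = j \<and> s - int m = 0) * of_bool (b = l \<and> t + int m = 0))"
      by (rule Sum_any.expand_superset) auto
    also have "\<dots> = (if s \<ge> 0 \<and> t = - s \<and> a = j \<and> b = l then fps_nth (R i j k l) (nat s) else 0)"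
      by auto
    finally show ?thesis .
  qed
  show ?thesis
    unfolding RLL_def feval_sum * by (rule sum_UNIV_delta2)
qed

lemma feval_LLR:
  assumes c: "\<And>g. c (\<iota> g) = triv g" and \<kappa>: "feval c \<kappa> = 1" and st: "\<sigma> = Plus \<or> \<tau> = Minus"
  shows "feval c (LLR \<iota> R \<kappa> \<sigma> \<tau> i j k l s t)
       = (if s \<ge> 0 \<and> t = - s then fps_nth (R i j k l) (nat s) else 0)"
proof -
  have *: "feval c (Sum_any (\<lambda>m::nat.
       lcoeff \<iota> \<tau> k b (t + int m) * lcoeff \<iota> \<sigma> i a (s - int m)
       * scal (fps_nth (R a j b l) m) * \<kappa> ^ m))
     = (if s \<ge> 0 \<and> t = - s \<and> a = i \<and> b = k then fps_nth (R i j k l) (nat s) else 0)" for a b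
  proof -
    have "finite {m. lcoeff \<iota> \<tau> k b (t + int m) * lcoeff \<iota> \<sigma> i a (s - int m)
       * scal (fps_nth (R a j b l) m) * \<kappa> ^ m \<noteq> 0}"
      by (rule finite_subset[OF _ finite_LL_support[OF st, of \<iota> i a s \<iota> k b t]]) auto
    then have "feval c (Sum_any (\<lambda>m::nat.
       lcoeff \<iota> \<tau> k b (t + int m) * lcoeff \<iota> \<sigma> i a (s - int m)
       * scal (fps_nth (R a j b l) m) * \<kappa> ^ m))
      = Sum_any (\<lambda>m. of_bool (k = b \<and> t + int m = 0) * of_bool (i = a \<and> s - int m = 0)
          * fps_nth (R a j b l) m)"
      by (simp add: feval_Sum_any feval_mult feval_power \<kappa> feval_lcoeff[of c \<iota>, OF c])
    also have "\<dots> = (\<Sum>m\<in>{nat s}. of_bool (k = b \<and> t + int m = 0)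
          * of_bool (i = a \<and> s - int m = 0) * fps_nth (R a j b l) m)"
      by (rule Sum_any.expand_superset) auto
    also have "\<dots> = (if s \<ge> 0 \<and> t = - s \<and> a = i \<and> b = k then fps_nth (R i j k l) (nat s) else 0)"
      by auto
    finally show ?thesis .
  qed
  show ?thesis
    unfolding LLR_def feval_sum * by (rule sum_UNIV_delta2)
qed

lemma feval_L_relators:
  assumes c: "\<And>g. c (\<iota> g) = triv g" and r: "r \<in> L_relators \<iota> R"
  shows "feval c r = 0"
proof -
  have same: "feval c (RLL \<iota> R 1 \<sigma> \<sigma> i j k l s t) = feval c (LLR \<iota> R 1 \<sigma> \<sigma> i j k l s t)"
    for \<sigma> i j k l s t
  proof -
    have "\<sigma> = Plus \<or> \<sigma> = Minus" by (cases \<sigma>) simp_all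
    then show ?thesis by (simp add: feval_RLL[of c \<iota>, OF c] feval_LLR[of c \<iota>, OF c])
  qed
  have mixed: "feval c (RLL \<iota> R (var (\<iota> Qc) ^ 2) Plus Minus i j k l s t)
      = feval c (LLR \<iota> R (var (\<iota> Qc_inv) ^ 2) Plus Minus i j k l s t)" for i j k l s t
    by (simp add: feval_RLL[of c \<iota>, OF c] feval_LLR[of c \<iota>, OF c] feval_power c)
  show ?thesis
    using r unfolding L_relators_def Let_def Un_iff
  proof (elim disjE, goal_cases)
    case 1 then show ?case by (auto simp: feval_diff feval_mult c)
  next
    case 2 then show ?case by (auto simp: feval_diff feval_mult c)
  next
    case 3 then show ?case by (auto simp: c)
  next
    case 4 then show ?case by (auto simp: c)
  next
    case 5 then show ?case by (auto simp: feval_diff feval_mult c)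
  next
    case 6 then show ?case by (auto simp: feval_diff feval_mult c)
  next
    case 7 then show ?case by (auto simp: feval_diff feval_mult c)
  next
    case 8
    then obtain \<sigma> i j k l s t where
      "r = RLL \<iota> R 1 \<sigma> \<sigma> i j k l s t - LLR \<iota> R 1 \<sigma> \<sigma> i j k l s t" by blast
    then show ?case by (simp add: feval_diff same)
  next
    case 9
    then obtain i j k l s t where
      "r = RLL \<iota> R (var (\<iota> Qc) ^ 2) Plus Minus i j k l s t
         - LLR \<iota> R (var (\<iota> Qc_inv) ^ 2) Plus Minus i j k l s t" by blast
    then show ?case by (simp add: feval_diff mixed)
  qed
qed

instantiation genR :: (finite) presented
begin
definition relators_genR :: "'a genR falg set" where "relators_genR = L_relators (\<lambda>g. g) Rmat"
instance
  by standard (rule one_notin_ideal_if_feval[where c = triv],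
    simp add: relators_genR_def feval_L_relators)
end

instantiation genRbar :: (finite) presented
begin
definition relators_genRbar :: "'a genRbar falg set"
  where "relators_genRbar = L_relators Bar Rbar"
instance
  by standard (rule one_notin_ideal_if_feval[where c = "\<lambda>g. case g of Bar h \<Rightarrow> triv h"],
    auto simp: relators_genRbar_def intro!: feval_L_relators)
end

type_synonym 'n UR = "'n genR presented_algebra"
type_synonym 'n URbar = "'n genRbar presented_algebra"

section \<open>Matrices of generating series\<close>

text \<open>Series in \<open>u\<close> (for the sign \<^term>\<open>Plus\<close>) and series in \<open>u\<^bsup>-1\<^esup>\<close> (for the sign \<^term>\<open>Minus\<close>) are
  both elements of type \<^typ>\<open>'a fps\<close>, so that replacing \<open>u\<close> by \<open>u \<xi>\<close> multiplies the coefficient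
  number \<open>m\<close> by \<open>\<xi>\<^bsup>m\<^esup>\<close> or \<open>\<xi>\<^bsup>-m\<^esup>\<close>.\<close>

type_synonym ('n, 'g) smat = "'g presented_algebra fps ^ 'n idx ^ 'n idx"

definition Lser :: "('n::finite genR \<Rightarrow> 'g::presented) \<Rightarrow> sign \<Rightarrow> ('n, 'g) smat"
  where "Lser \<iota> s = (\<chi> i j. Abs_fps (\<lambda>m. gen (\<iota> (L s i j m))))"

definition subst_xi :: "sign \<Rightarrow> ('n::finite, 'g::presented) smat \<Rightarrow> ('n, 'g) smat"
  where "subst_xi s A = (\<chi> i j. Abs_fps (\<lambda>m.
    of_Cq (xi TYPE('n) powi (case s of Plus \<Rightarrow> int m | Minus \<Rightarrow> - int m)) * fps_nth (A $ i $ j) m))"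

text \<open>The coefficient at \<open>e\<^bsub>ab\<^esub>\<close> is the sum of the contributions of
  \<open>e\<^bsub>ij\<^esub>\<^sup>t = \<epsilon>\<^sub>i \<epsilon>\<^sub>j e\<^bsub>j'i'\<^esub>\<close>, that is, of \<open>i = b'\<close> and \<open>j = a'\<close>.\<close>
definition tr :: "('n::finite, 'g::presented) smat \<Rightarrow> ('n, 'g) smat"
  where "tr A = (\<chi> a b. of_int (eps (b\<^sup>*) * eps (a\<^sup>*)) * A $ (b\<^sup>*) $ (a\<^sup>*))"

definition Dmat :: "('n::finite, 'g::presented) smat"
  where "Dmat = (\<chi> i j. if i = j then fps_const (of_Cq (q powi bar i)) else 0)"

definition Dinv :: "('n::finite, 'g::presented) smat"
  where "Dinv = (\<chi> i j. if i = j then fps_const (of_Cq (q powi (- bar i))) else 0)"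

lemma of_Cq_mult: "of_Cq a * of_Cq b = of_Cq (a * b)"
  by (simp add: of_Cq_def scal_def mult_single flip: quot_map_hom(6))

lemma of_Cq_1: "of_Cq 1 = 1"
  by (simp add: of_Cq_def scal_def quot_map_hom(2))

lemma diag_mult:
  fixes a b :: "'n::finite \<Rightarrow> 'a::semiring_1"
  shows "(\<chi> i j. if i = j then a i else 0) ** (\<chi> i j. if i = j then b i else 0)
       = (\<chi> i j. if i = j then a i * b i else 0)"
proof -
  have "(if i = k then a i else 0) * (if k = j then b k else 0)
      = (if k = i then if i = j then a i * b i else 0 else 0)" for i j k
    by simp
  then show ?thesis by (simp add: matrix_matrix_mult_def vec_eq_iff)
qed

lemma Dmat_Dinv:
  "Dmat ** Dinv = (mat 1 :: ('n::finite, 'g::presented) smat)"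
  "Dinv ** Dmat = (mat 1 :: ('n::finite, 'g::presented) smat)"
proof -
  have "fps_const (of_Cq (q powi k)) * fps_const (of_Cq (q powi (- k)))
      = (1 :: 'g presented_algebra fps)" for k
    using q_neq_0 by (simp add: of_Cq_mult of_Cq_1 power_int_minus)
  from this this[of "- _"] show
    "Dmat ** Dinv = (mat 1 :: ('n, 'g) smat)" "Dinv ** Dmat = (mat 1 :: ('n, 'g) smat)"
    by (simp_all only: Dmat_def Dinv_def diag_mult mat_def minus_minus)
qed

end

theory Submission
  imports Defs
begin

text \<open>Put \<open>x = u/v\<close>. Every homogeneous part of \<open>L\<^sub>1(u) L\<^sub>2(v)\<close> is a polynomial in \<open>x\<close>, and up to a
  unit of the ring of power series \<open>R(x)\<close> is a polynomial too. So the relation between series of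
  equal signs can be evaluated at \<open>x = \<xi>\<close>, where \<open>R\<close> has a simple pole with residue proportional to
  \<open>Q\<close>. This gives \<open>Q L\<^sub>1(u\<xi>) L\<^sub>2(u) = L\<^sub>2(u) L\<^sub>1(u\<xi>) Q\<close>. As \<open>Q\<close> has rank one, both sides are
  \<open>z(u) Q\<close> for a series \<open>z(u)\<close>, and the entries of these two equations are the two assertions.\<close>

section \<open>Central scalars\<close>

lemma scal_add: "scal (a + b) = scal a + scal b"
  by (simp add: scal_def single_add)

lemma of_Cq_add: "of_Cq (a + b) = of_Cq a + of_Cq b"
  by (simp add: of_Cq_def scal_add quot_map_hom)

lemma of_Cq_0: "of_Cq 0 = 0"
  by (simp add: of_Cq_def scal_def quot_map_hom)

lemma of_Cq_diff: "of_Cq (a - b) = of_Cq a - of_Cq b"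
  by (simp add: of_Cq_def scal_def single_diff quot_map_hom)

lemma of_Cq_uminus: "of_Cq (- a) = - of_Cq a"
  using of_Cq_diff[of 0 a] by (simp add: of_Cq_0)

lemma of_Cq_sum: "of_Cq (sum f A) = (\<Sum>a\<in>A. of_Cq (f a))"
  by (induction A rule: infinite_finite_induct) (simp_all add: of_Cq_0 of_Cq_add)

lemma quot_map_sum: "quot_map (sum f A) = (\<Sum>a\<in>A. quot_map (f a))"
  by (induction A rule: infinite_finite_induct) (simp_all add: quot_map_hom)

text \<open>Scalars sit on the empty word, which is neutral for concatenation on either
  side.\<close>

lemma scal_commute: "scal a * x = x * scal a"
  by (induction x rule: falg_induct)
    (simp_all add: scal_def mult_single distrib_left distrib_right mult.commute)

lemma of_Cq_commute: "of_Cq a * x = x * of_Cq a"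
proof -
  have "\<exists>y. x = quot_map y"
    unfolding quot_map_def by (induction x rule: presented_algebra.abs_induct) blast
  then show ?thesis by (auto simp: of_Cq_def scal_commute simp flip: quot_map_hom(6))
qed

text \<open>The entries of the R-matrices act on series over the noncommutative algebra through this
  ring homomorphism, whose image is central.\<close>

definition fps_of_Cq :: "Cq fps \<Rightarrow> 'g::presented presented_algebra fps"
  where "fps_of_Cq f = Abs_fps (\<lambda>m. of_Cq (fps_nth f m))"

lemma fps_of_Cq_nth [simp]: "fps_nth (fps_of_Cq f) m = of_Cq (fps_nth f m)"
  by (simp add: fps_of_Cq_def)

lemma fps_of_Cq_add: "fps_of_Cq (f + g) = fps_of_Cq f + fps_of_Cq g"
  by (simp add: fps_eq_iff of_Cq_add)

lemma fps_of_Cq_mult: "fps_of_Cq (f * g) = fps_of_Cq f * fps_of_Cq g"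
  by (simp add: fps_eq_iff fps_mult_nth of_Cq_sum of_Cq_mult)

lemma fps_of_Cq_commute: "fps_of_Cq f * x = x * fps_of_Cq f"
proof (rule fps_ext)
  fix m
  have "fps_nth (x * fps_of_Cq f) m = (\<Sum>i=0..m. fps_nth x (m - i) * fps_nth (fps_of_Cq f) i)"
    unfolding fps_mult_nth by (rule sum.reindex_bij_witness[of _ "\<lambda>i. m - i" "\<lambda>i. m - i"]) auto
  then show "fps_nth (fps_of_Cq f * x) m = fps_nth (x * fps_of_Cq f) m"
    by (simp add: fps_mult_nth of_Cq_commute)
qed

lemma fps_of_Cq_const: "fps_of_Cq (fps_const a) = fps_const (of_Cq a)"
  by (simp add: fps_eq_iff of_Cq_0)

lemma fps_of_Cq_1: "fps_of_Cq 1 = 1"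
  by (simp add: fps_eq_iff of_Cq_0 of_Cq_1)

lemma fps_of_Cq_0: "fps_of_Cq 0 = 0"
  by (simp add: fps_eq_iff of_Cq_0)

section \<open>Numerators of the R-matrices\<close>

text \<open>The numerator \<open>(x q - q\<^bsup>-1\<^esup>) (x - \<xi>) R(x)\<close> of \<open>Rbar\<close> is the polynomial
  \<open>(x - \<xi>) Rquo(x) + c Q\<close> with the nonzero constant \<open>c = (q - q\<^bsup>-1\<^esup>) (1 - \<xi>) \<xi>\<close>.\<close>
definition Rquo :: "('n::finite, Cq fps) tensor2"
  where "Rquo a b c d =
     (fps_X - 1) * fps_const (Rconst a b c d) + fps_const ((q - inverse q) * Pmat a b c d)
     - fps_const ((q - inverse q) * xi TYPE('n) * Qmat a b c d)"

definition Rnum :: "('n::finite, Cq fps) tensor2"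
  where "Rnum a b c d = (fps_X - fps_const (xi TYPE('n))) * Rquo a b c d
     + fps_const ((q - inverse q) * (1 - xi TYPE('n)) * xi TYPE('n) * Qmat a b c d)"

lemma q_power_neq_1: "k > 0 \<Longrightarrow> q ^ k \<noteq> 1"
proof
  assume "k > 0" "q ^ k = 1"
  then have "monom (1::complex) k = monom 1 0"
    by (simp add: q_power One_fract_def eq_fract)
  then have "degree (monom (1::complex) k) = degree (monom (1::complex) 0)" by simp
  with \<open>k > 0\<close> show False by (simp add: degree_monom_eq)
qed

lemma xi_neq_0: "xi t \<noteq> 0"
  using q_neq_0 by (simp add: xi_def)

lemma xi_neq_1: "xi (t :: 'n::finite itself) \<noteq> 1"
proof -
  have "- 2 * int CARD('n) - 2 = - int (2 * CARD('n) + 2)" by simp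
  then have "xi t = inverse (q ^ (2 * CARD('n) + 2))"
    by (simp only: xi_def power_int_minus power_int_of_nat)
  moreover have "q ^ (2 * CARD('n) + 2) \<noteq> 1" by (rule q_power_neq_1) simp
  ultimately show ?thesis by (simp only: inverse_eq_1_iff not_False_eq_True)
qed

lemma q_diff_neq_0: "q - inverse q \<noteq> 0"
proof
  assume "q - inverse q = 0"
  then have "q ^ 2 = 1" using q_neq_0 by (simp add: power2_eq_square field_simps)
  then show False using q_power_neq_1[of 2] by simp
qed

text \<open>After cancelling \<open>a * a'\<close> and \<open>b * b'\<close>, substitute
  \<open>x - 1 = b - (1 - \<xi>)\<close> in the last term: its part divisible by \<open>b\<close>
  joins the bracket, the rest is constant in \<open>x\<close>.\<close>

lemma clear_two_denominators:
  "a * b * ((x - 1) * a' * r + k * a' * p - k * (x - 1) * \<xi> * (a' * b') * w)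
      = b * ((x - 1) * r + k * p - k * \<xi> * w) + k * (1 - \<xi>) * \<xi> * w"
    if 1: "a * a' = 1" and 2: "b * b' = 1" and 3: "b = x - \<xi>"
  for a a' b b' x \<xi> r k p w :: "'a::comm_ring_1"
proof -
  have "a * b * ((x - 1) * a' * r + k * a' * p - k * (x - 1) * \<xi> * (a' * b') * w)
     = (a * a') * (b * ((x - 1) * r + k * p) - k * (x - 1) * \<xi> * (b * b') * w)"
    by (simp add: algebra_simps)
  also have "\<dots> = b * ((x - 1) * r + k * p) - k * (x - 1) * \<xi> * w"
    by (simp only: 1 2 mult_1 mult_1_right)
  also have "\<dots> = b * ((x - 1) * r + k * p - k * \<xi> * w) + k * (1 - \<xi>) * \<xi> * w"
    by (simp add: 3 algebra_simps)
  finally show ?thesis .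
qed

lemma Rbar_numerator:
  fixes a b c d :: "'n::finite idx"
  shows "(fps_X * fps_const q - fps_const (inverse q)) * (fps_X - fps_const (xi TYPE('n)))
     * Rbar a b c d = Rnum a b c d"
proof -
  let ?A = "fps_X * fps_const q - fps_const (inverse q)" and ?B = "fps_X - fps_const (xi TYPE('n))"
  have "?A * inverse ?A = 1" "?B * inverse ?B = 1"
    using q_neq_0 xi_neq_0[of "TYPE('n)"] by (auto intro!: inverse_mult_eq_1')
  from clear_two_denominators[OF this refl, of "fps_const (Rconst a b c d)" "fps_const (q - inverse q)"]
  show ?thesis
    by (simp only: Rbar_def Rnum_def Rquo_def Let_def fps_inverse_mult
        fps_const_mult[symmetric] fps_const_sub[symmetric] fps_const_1_eq_1)
qed

text \<open>The constant term of g is that of f times \<open>q powi (- 2) * \<xi>\<close>, hence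
  nonzero. So g is a unit, and both R-matrices have the same numerator up to a power series
  factor.\<close>

lemma Rmat_numerator:
  fixes a b c d :: "'n::finite idx"
  shows "inverse (gfun TYPE('n)) * ((fps_X * fps_const q - fps_const (inverse q))
     * (fps_X - fps_const (xi TYPE('n)))) * Rmat a b c d = Rnum a b c d"
proof -
  have "is_normalizer TYPE('n) (ffun TYPE('n))"
    unfolding ffun_def by (rule theI'[OF ex1_normalizer])
  then have "fps_nth (ffun TYPE('n)) 0 = 1"
    by (simp add: is_normalizer_def Let_def)
  then have "fps_nth (gfun TYPE('n)) 0 \<noteq> 0"
    using q_neq_0 xi_neq_0 by (simp add: gfun_def)
  then have "inverse (gfun TYPE('n)) * gfun TYPE('n) = 1"
    by (rule inverse_mult_eq_1)
  moreover have "inverse g * h * (g * r) = (inverse g * g) * (h * r)" for g h r :: "Cq fps"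
    by (simp only: ac_simps)
  ultimately show ?thesis
    by (simp only: Rmat_def Rbar_numerator mult_1)
qed

section \<open>Evaluation of polynomials\<close>

text \<open>A general series has no value at a nonzero point. The cutoff \<open>M\<close> makes the
  sum finite, and the result is the true value once \<open>F\<close> is a polynomial of degree at
  most \<open>M\<close>.\<close>

definition fps_eval :: "Cq \<Rightarrow> nat \<Rightarrow> 'g::presented presented_algebra fps \<Rightarrow> 'g presented_algebra"
  where "fps_eval x M F = (\<Sum>p\<le>M. of_Cq (x ^ p) * fps_nth F p)"

lemma fps_eval_diff: "fps_eval x M (F - G) = fps_eval x M F - fps_eval x M G"
  by (simp add: fps_eval_def right_diff_distrib sum_subtractf)

lemma fps_eval_sum: "fps_eval x M (sum F A) = (\<Sum>a\<in>A. fps_eval x M (F a))"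
  unfolding fps_eval_def fps_sum_nth sum_distrib_left by (rule sum.swap)

lemma fps_eval_const_mult:
  "fps_eval x M (fps_of_Cq (fps_const c) * F) = of_Cq c * fps_eval x M F"
  by (simp add: fps_eval_def fps_of_Cq_const of_Cq_mult sum_distrib_left mult.commute[of c]
      flip: mult.assoc)

lemma fps_eval_degree:
  "N \<le> M \<Longrightarrow> (\<And>p. p > N \<Longrightarrow> fps_nth F p = 0) \<Longrightarrow> fps_eval x M F = fps_eval x N F"
  unfolding fps_eval_def by (rule sum.mono_neutral_right) auto

lemma fps_mult_degree:
  fixes F G :: "'a::semiring_0 fps"
  assumes "\<And>p. p > m \<Longrightarrow> fps_nth F p = 0" "\<And>p. p > n \<Longrightarrow> fps_nth G p = 0" "p > m + n"
  shows "fps_nth (F * G) p = 0"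
  unfolding fps_mult_nth
proof (intro sum.neutral ballI)
  fix i assume "i \<in> {0..p}"
  then have "i > m \<or> p - i > n" using assms(3) by auto
  then show "fps_nth F i * fps_nth G (p - i) = 0" using assms(1,2) by auto
qed

text \<open>The sum telescopes: cut off at any \<open>M\<close> it equals
  \<open>- x ^ (M + 1)\<close> times the coefficient of \<open>W\<close> at \<open>M\<close>, which
  vanishes for \<open>M = N + 1\<close>.\<close>

lemma fps_eval_root:
  fixes W :: "'g::presented presented_algebra fps"
  assumes "\<And>p. p > N \<Longrightarrow> fps_nth W p = 0"
  shows "fps_eval x (Suc N) (fps_of_Cq (fps_X - fps_const x) * W) = 0"
proof -
  have "fps_of_Cq (fps_X - fps_const x) = (fps_X - fps_const (of_Cq x) :: 'g presented_algebra fps)"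
    by (simp add: fps_eq_iff of_Cq_diff of_Cq_0 of_Cq_1 fps_X_def)
  then have *: "fps_nth (fps_of_Cq (fps_X - fps_const x) * W) p
      = (if p = 0 then 0 else fps_nth W (p - 1)) - of_Cq x * fps_nth W p" for p
    by (simp add: left_diff_distrib)
  have "(\<Sum>p\<le>M. of_Cq (x ^ p) * fps_nth (fps_of_Cq (fps_X - fps_const x) * W) p)
      = - of_Cq (x ^ Suc M) * fps_nth W M" for M
  proof (induction M)
    case (Suc M)
    have "of_Cq (x ^ Suc M) * (of_Cq x * fps_nth W (Suc M))
        = of_Cq (x ^ Suc (Suc M)) * fps_nth W (Suc M)"
      by (simp only: of_Cq_mult power_Suc2 flip: mult.assoc)
    with Suc show ?case by (simp add: * right_diff_distrib del: power_Suc)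
  next
    case 0
    show ?case by (simp add: * of_Cq_1 del: fps_mult_nth_0)
  qed
  then show ?thesis using assms by (simp add: fps_eval_def)
qed

section \<open>The relation at the pole\<close>

text \<open>The coefficient of \<open>x\<^sup>p\<close> in the homogeneous part of degree \<open>N\<close> (in \<open>v\<close> for the sign \<open>Plus\<close>, in
  \<open>u\<^bsup>-1\<^esup>\<close> for the sign \<open>Minus\<close>) is the coefficient of \<open>u\<^sup>s v\<^sup>t\<close> for \<open>s = uexp \<sigma> N + p\<close> and
  \<open>t = vexp \<sigma> N - p\<close>.\<close>
definition uexp :: "sign \<Rightarrow> nat \<Rightarrow> int"
  where "uexp \<sigma> N = (case \<sigma> of Plus \<Rightarrow> 0 | Minus \<Rightarrow> - int N)"

definition vexp :: "sign \<Rightarrow> nat \<Rightarrow> int"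
  where "vexp \<sigma> N = (case \<sigma> of Plus \<Rightarrow> int N | Minus \<Rightarrow> 0)"

definition L1L2 :: "('n::finite genR \<Rightarrow> 'g::presented) \<Rightarrow> sign \<Rightarrow> nat \<Rightarrow> 'n idx \<Rightarrow> 'n idx \<Rightarrow> 'n idx
    \<Rightarrow> 'n idx \<Rightarrow> 'g presented_algebra fps"
  where "L1L2 \<iota> \<sigma> N i j k l = Abs_fps (\<lambda>p. quot_map
    (lcoeff \<iota> \<sigma> i j (uexp \<sigma> N + int p) * lcoeff \<iota> \<sigma> k l (vexp \<sigma> N - int p)))"

definition L2L1 :: "('n::finite genR \<Rightarrow> 'g::presented) \<Rightarrow> sign \<Rightarrow> nat \<Rightarrow> 'n idx \<Rightarrow> 'n idx \<Rightarrow> 'n idx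
    \<Rightarrow> 'n idx \<Rightarrow> 'g presented_algebra fps"
  where "L2L1 \<iota> \<sigma> N i j k l = Abs_fps (\<lambda>p. quot_map
    (lcoeff \<iota> \<sigma> k l (vexp \<sigma> N - int p) * lcoeff \<iota> \<sigma> i j (uexp \<sigma> N + int p)))"

lemma L1L2_degree: "p > N \<Longrightarrow> fps_nth (L1L2 \<iota> \<sigma> N i j k l) p = 0"
  by (cases \<sigma>) (auto simp: L1L2_def lcoeff_def uexp_def vexp_def quot_map_hom)

lemma L2L1_degree: "p > N \<Longrightarrow> fps_nth (L2L1 \<iota> \<sigma> N i j k l) p = 0"
  by (cases \<sigma>) (auto simp: L2L1_def lcoeff_def uexp_def vexp_def quot_map_hom)

section \<open>The defining relation as an identity of power series in x\<close>

lemma lcoeff_negative_degree: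
  assumes "p < 0"
  shows "lcoeff \<iota> \<sigma> i j (uexp \<sigma> N + p) = 0 \<or> lcoeff \<iota> \<sigma> k l (vexp \<sigma> N - p) = 0"
  using assms by (cases \<sigma>) (auto simp: lcoeff_def uexp_def vexp_def)

lemma Sum_any_eq_sum_atMost:
  assumes "\<And>m. m > (p::nat) \<Longrightarrow> g m = 0"
  shows "Sum_any g = (\<Sum>m=0..p. g m)"
  by (rule Sum_any.expand_superset) (use assms in \<open>auto simp: not_less[symmetric]\<close>)

text \<open>Taking the term of degree m from R lowers p to p - m in both exponents. Terms with m > p
  vanish, because then one of the two generating series has an exponent of the wrong sign; what
  remains is a Cauchy product.\<close>

lemma quot_map_RLL:
  "quot_map (RLL \<iota> R 1 \<sigma> \<sigma> i j k l (uexp \<sigma> N + int p) (vexp \<sigma> N - int p))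
    = fps_nth (\<Sum>a\<in>UNIV. \<Sum>b\<in>UNIV. fps_of_Cq (R i a k b) * L1L2 \<iota> \<sigma> N a j b l) p"
proof -
  have "quot_map (Sum_any (\<lambda>m::nat. scal (fps_nth (R i a k b) m) * 1 ^ m
       * lcoeff \<iota> \<sigma> a j (uexp \<sigma> N + int p - int m) * lcoeff \<iota> \<sigma> b l (vexp \<sigma> N - int p + int m)))
     = fps_nth (fps_of_Cq (R i a k b) * L1L2 \<iota> \<sigma> N a j b l) p" for a b
  proof (subst Sum_any_eq_sum_atMost[of p])
    fix m assume "m > p"
    then show "scal (fps_nth (R i a k b) m) * 1 ^ m
       * lcoeff \<iota> \<sigma> a j (uexp \<sigma> N + int p - int m) * lcoeff \<iota> \<sigma> b l (vexp \<sigma> N - int p + int m) = 0"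
      using lcoeff_negative_degree[of "int p - int m" \<iota> \<sigma> a j N b l] by (auto simp: algebra_simps)
  next
    show "quot_map (\<Sum>m=0..p. scal (fps_nth (R i a k b) m) * 1 ^ m
       * lcoeff \<iota> \<sigma> a j (uexp \<sigma> N + int p - int m) * lcoeff \<iota> \<sigma> b l (vexp \<sigma> N - int p + int m))
     = fps_nth (fps_of_Cq (R i a k b) * L1L2 \<iota> \<sigma> N a j b l) p"
      unfolding fps_mult_nth quot_map_sum
      by (intro sum.cong refl)
        (simp add: L1L2_def of_Cq_def of_nat_diff algebra_simps flip: quot_map_hom(6))
  qed
  then show ?thesis by (simp only: RLL_def quot_map_sum fps_sum_nth)
qed

lemma quot_map_LLR:
  "quot_map (LLR \<iota> R 1 \<sigma> \<sigma> i j k l (uexp \<sigma> N + int p) (vexp \<sigma> N - int p))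
    = fps_nth (\<Sum>a\<in>UNIV. \<Sum>b\<in>UNIV. L2L1 \<iota> \<sigma> N i a k b * fps_of_Cq (R a j b l)) p"
proof -
  have "quot_map (Sum_any (\<lambda>m::nat. lcoeff \<iota> \<sigma> k b (vexp \<sigma> N - int p + int m)
       * lcoeff \<iota> \<sigma> i a (uexp \<sigma> N + int p - int m) * scal (fps_nth (R a j b l) m) * 1 ^ m))
     = fps_nth (fps_of_Cq (R a j b l) * L2L1 \<iota> \<sigma> N i a k b) p" for a b
  proof (subst Sum_any_eq_sum_atMost[of p])
    fix m assume "m > p"
    then show "lcoeff \<iota> \<sigma> k b (vexp \<sigma> N - int p + int m)
       * lcoeff \<iota> \<sigma> i a (uexp \<sigma> N + int p - int m) * scal (fps_nth (R a j b l) m) * 1 ^ m = 0"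
      using lcoeff_negative_degree[of "int p - int m" \<iota> \<sigma> i a N k b] by (auto simp: algebra_simps)
  next
    show "quot_map (\<Sum>m=0..p. lcoeff \<iota> \<sigma> k b (vexp \<sigma> N - int p + int m)
       * lcoeff \<iota> \<sigma> i a (uexp \<sigma> N + int p - int m) * scal (fps_nth (R a j b l) m) * 1 ^ m)
     = fps_nth (fps_of_Cq (R a j b l) * L2L1 \<iota> \<sigma> N i a k b) p"
      unfolding fps_mult_nth quot_map_sum
      by (intro sum.cong refl)
        (simp add: L2L1_def of_Cq_def of_nat_diff algebra_simps scal_commute[of "fps_nth _ _"]
          flip: quot_map_hom(6))
  qed
  then show ?thesis by (simp only: LLR_def quot_map_sum fps_sum_nth fps_of_Cq_commute)
qed

section \<open>Substituting \<xi> for x\<close>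

lemma L1L2_nth:
  "p \<le> N \<Longrightarrow> fps_nth (L1L2 \<iota> \<sigma> N i j k l) p = (case \<sigma> of
     Plus \<Rightarrow> fps_nth (Lser \<iota> \<sigma> $ i $ j) p * fps_nth (Lser \<iota> \<sigma> $ k $ l) (N - p)
   | Minus \<Rightarrow> fps_nth (Lser \<iota> \<sigma> $ i $ j) (N - p) * fps_nth (Lser \<iota> \<sigma> $ k $ l) p)"
  by (cases \<sigma>) (auto simp: L1L2_def lcoeff_def uexp_def vexp_def Lser_def gen_def quot_map_hom
      nat_diff_distrib)

lemma L2L1_nth:
  "p \<le> N \<Longrightarrow> fps_nth (L2L1 \<iota> \<sigma> N i j k l) p = (case \<sigma> of
     Plus \<Rightarrow> fps_nth (Lser \<iota> \<sigma> $ k $ l) (N - p) * fps_nth (Lser \<iota> \<sigma> $ i $ j) p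
   | Minus \<Rightarrow> fps_nth (Lser \<iota> \<sigma> $ k $ l) p * fps_nth (Lser \<iota> \<sigma> $ i $ j) (N - p))"
  by (cases \<sigma>) (auto simp: L2L1_def lcoeff_def uexp_def vexp_def Lser_def gen_def quot_map_hom
      nat_diff_distrib)

text \<open>For the sign \<open>Minus\<close>, setting \<open>x = \<xi>\<close> turns \<open>L\<^sub>1(u) L\<^sub>2(v)\<close> into \<open>L\<^sub>1(u) L\<^sub>2(u \<xi>\<^bsup>-1\<^esup>)\<close>, whose part of
  degree \<open>N\<close> is \<open>\<xi>\<^sup>N\<close> times that of \<open>L\<^sub>1(u \<xi>) L\<^sub>2(u)\<close>.\<close>
definition xi_norm :: "'n::finite itself \<Rightarrow> sign \<Rightarrow> nat \<Rightarrow> Cq"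
  where "xi_norm t \<sigma> N = (case \<sigma> of Plus \<Rightarrow> 1 | Minus \<Rightarrow> xi t ^ N)"

lemma xi_norm_neq_0: "xi_norm t \<sigma> N \<noteq> 0"
  by (cases \<sigma>) (simp_all add: xi_norm_def xi_neq_0)

lemma xi_norm_subst_xi:
  fixes A :: "('n::finite, 'g::presented) smat"
  assumes "m \<le> N"
  shows "of_Cq (xi_norm TYPE('n) \<sigma> N) * fps_nth (subst_xi \<sigma> A $ i $ j) m
    = of_Cq (xi TYPE('n) ^ (case \<sigma> of Plus \<Rightarrow> m | Minus \<Rightarrow> N - m)) * fps_nth (A $ i $ j) m"
proof -
  have "xi TYPE('n) ^ N = xi TYPE('n) ^ (N - m) * xi TYPE('n) ^ m"
    using assms by (simp flip: power_add)
  then have "xi TYPE('n) ^ N * inverse (xi TYPE('n) ^ m) = xi TYPE('n) ^ (N - m)"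
    using xi_neq_0[of "TYPE('n)"] by simp
  then have "xi_norm TYPE('n) \<sigma> N * xi TYPE('n) powi (case \<sigma> of Plus \<Rightarrow> int m | Minus \<Rightarrow> - int m)
      = xi TYPE('n) ^ (case \<sigma> of Plus \<Rightarrow> m | Minus \<Rightarrow> N - m)"
    by (cases \<sigma>) (simp_all add: xi_norm_def power_int_minus)
  then show ?thesis
    by (simp add: subst_xi_def of_Cq_mult flip: mult.assoc)
qed

lemma eval_L1L2:
  fixes \<iota> :: "'n::finite genR \<Rightarrow> 'g::presented"
  shows "fps_eval (xi TYPE('n)) N (L1L2 \<iota> \<sigma> N i j k l) = of_Cq (xi_norm TYPE('n) \<sigma> N)
    * fps_nth (subst_xi \<sigma> (Lser \<iota> \<sigma>) $ i $ j * Lser \<iota> \<sigma> $ k $ l) N"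
proof -
  have "of_Cq (xi_norm TYPE('n) \<sigma> N) * fps_nth (subst_xi \<sigma> (Lser \<iota> \<sigma>) $ i $ j * Lser \<iota> \<sigma> $ k $ l) N
    = (\<Sum>m\<le>N. of_Cq (xi TYPE('n) ^ (case \<sigma> of Plus \<Rightarrow> m | Minus \<Rightarrow> N - m))
        * (fps_nth (Lser \<iota> \<sigma> $ i $ j) m * fps_nth (Lser \<iota> \<sigma> $ k $ l) (N - m)))"
    unfolding fps_mult_nth sum_distrib_left atMost_atLeast0
    by (intro sum.cong refl) (simp add: xi_norm_subst_xi flip: mult.assoc)
  \<comment> \<open>The product is indexed by the coefficient number of its first factor. This
    number is p for \<open>Plus\<close> but N - p for \<open>Minus\<close>, whence the
    reflection.\<close>
  also have "\<dots> = fps_eval (xi TYPE('n)) N (L1L2 \<iota> \<sigma> N i j k l)"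
    unfolding fps_eval_def
    by (cases \<sigma>; rule sum.reindex_bij_witness[of _ "\<lambda>m. case \<sigma> of Plus \<Rightarrow> m | Minus \<Rightarrow> N - m"
          "\<lambda>m. case \<sigma> of Plus \<Rightarrow> m | Minus \<Rightarrow> N - m"])
      (auto simp: L1L2_nth)
  finally show ?thesis ..
qed

lemma eval_L2L1:
  fixes \<iota> :: "'n::finite genR \<Rightarrow> 'g::presented"
  shows "fps_eval (xi TYPE('n)) N (L2L1 \<iota> \<sigma> N i j k l) = of_Cq (xi_norm TYPE('n) \<sigma> N)
    * fps_nth (Lser \<iota> \<sigma> $ k $ l * subst_xi \<sigma> (Lser \<iota> \<sigma>) $ i $ j) N"
proof -
  have "of_Cq (xi_norm TYPE('n) \<sigma> N) * fps_nth (Lser \<iota> \<sigma> $ k $ l * subst_xi \<sigma> (Lser \<iota> \<sigma>) $ i $ j) N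
    = (\<Sum>m\<le>N. fps_nth (Lser \<iota> \<sigma> $ k $ l) m
        * (of_Cq (xi_norm TYPE('n) \<sigma> N) * fps_nth (subst_xi \<sigma> (Lser \<iota> \<sigma>) $ i $ j) (N - m)))"
    unfolding fps_mult_nth sum_distrib_left atMost_atLeast0
    by (simp only: of_Cq_commute mult.assoc)
  also have "\<dots> = (\<Sum>m\<le>N. of_Cq (xi TYPE('n) ^ (case \<sigma> of Plus \<Rightarrow> N - m | Minus \<Rightarrow> m))
        * (fps_nth (Lser \<iota> \<sigma> $ k $ l) m * fps_nth (Lser \<iota> \<sigma> $ i $ j) (N - m)))"
    unfolding xi_norm_subst_xi[OF diff_le_self]
    by (intro sum.cong refl; cases \<sigma>) (simp_all add: of_Cq_commute mult.assoc)
  \<comment> \<open>Now the second series stands first, so the reflection is needed for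
    \<open>Plus\<close> instead.\<close>
  also have "\<dots> = fps_eval (xi TYPE('n)) N (L2L1 \<iota> \<sigma> N i j k l)"
    unfolding fps_eval_def
    by (cases \<sigma>; rule sum.reindex_bij_witness[of _ "\<lambda>m. case \<sigma> of Plus \<Rightarrow> N - m | Minus \<Rightarrow> m"
          "\<lambda>m. case \<sigma> of Plus \<Rightarrow> N - m | Minus \<Rightarrow> m"])
      (auto simp: L2L1_nth)
  finally show ?thesis ..
qed

section \<open>Extracting the relation for Q\<close>

lemma Rquo_degree: "p > 1 \<Longrightarrow> fps_nth (Rquo a b c d) p = 0"
  by (cases p) (auto simp: Rquo_def left_diff_distrib fps_X_def)

text \<open>Multiplying the relation by \<open>h\<close> replaces \<open>R\<close> by
  \<open>Rnum\<close>. In each degree N this reads \<open>(x - \<xi>) W + c Z = 0\<close>, where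
  \<open>W\<close> collects the terms with \<open>Rquo\<close> and \<open>Z\<close> those with
  \<open>Q\<close>; at \<open>x = \<xi>\<close> only \<open>c Z\<close> survives. Only
  \<open>num\<close> is assumed about \<open>R\<close>, so both algebras are covered.\<close>

lemma Q_subst_xi_L:
  fixes \<iota> :: "'n::finite genR \<Rightarrow> 'g::presented" and R :: "('n, Cq fps) tensor2" and \<sigma> :: sign
  defines "A \<equiv> Lser \<iota> \<sigma>"
  assumes rel: "\<And>i j k l s t. RLL \<iota> R 1 \<sigma> \<sigma> i j k l s t - LLR \<iota> R 1 \<sigma> \<sigma> i j k l s t \<in> relators"
    and num: "\<And>a b c d. h * R a b c d = Rnum a b c d"
  shows "(\<Sum>a\<in>UNIV. \<Sum>b\<in>UNIV. fps_of_Cq (fps_const (Qmat i a k b)) * (subst_xi \<sigma> A $ a $ j * A $ b $ l))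
    = (\<Sum>a\<in>UNIV. \<Sum>b\<in>UNIV. fps_of_Cq (fps_const (Qmat a j b l)) * (A $ k $ b * subst_xi \<sigma> A $ i $ a))"
    (is "?lhs = ?rhs")
proof (rule fps_ext)
  fix N
  define \<xi> c where "\<xi> = xi TYPE('n)" and "c = (q - inverse q) * (1 - xi TYPE('n)) * xi TYPE('n)"
  have Rnum: "fps_of_Cq (Rnum a b d e) = (fps_of_Cq (fps_X - fps_const \<xi>) * fps_of_Cq (Rquo a b d e)
      + fps_of_Cq (fps_const c) * fps_of_Cq (fps_const (Qmat a b d e)) :: 'g presented_algebra fps)"
    for a b d e :: "'n idx"
    by (simp add: Rnum_def \<xi>_def c_def fps_of_Cq_add flip: fps_of_Cq_mult)
  define F G where "F a b = L1L2 \<iota> \<sigma> N a j b l" and "G a b = L2L1 \<iota> \<sigma> N i a k b" for a b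
  define W Z where "W = (\<Sum>a\<in>UNIV. \<Sum>b\<in>UNIV. fps_of_Cq (Rquo i a k b) * F a b - fps_of_Cq (Rquo a j b l) * G a b)"
    and "Z = (\<Sum>a\<in>UNIV. \<Sum>b\<in>UNIV. fps_of_Cq (fps_const (Qmat i a k b)) * F a b
      - fps_of_Cq (fps_const (Qmat a j b l)) * G a b)"
  have "RLL \<iota> R 1 \<sigma> \<sigma> i j k l s t - LLR \<iota> R 1 \<sigma> \<sigma> i j k l s t \<in> two_sided_ideal relators" for s t
    using two_sided_ideal.base[OF rel, of 1 _ _ _ _ _ _ 1] by simp
  then have "(\<Sum>a\<in>UNIV. \<Sum>b\<in>UNIV. fps_of_Cq (R i a k b) * F a b)
      = (\<Sum>a\<in>UNIV. \<Sum>b\<in>UNIV. G a b * fps_of_Cq (R a j b l))"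
    unfolding F_def G_def
    by (intro fps_ext) (simp only: quot_map_eq_iff flip: quot_map_RLL quot_map_LLR)
  from arg_cong[OF this, of "\<lambda>x. fps_of_Cq h * x"]
  have "(\<Sum>a\<in>UNIV. \<Sum>b\<in>UNIV. fps_of_Cq (Rnum i a k b) * F a b)
      = (\<Sum>a\<in>UNIV. \<Sum>b\<in>UNIV. fps_of_Cq (Rnum a j b l) * G a b)"
    by (simp add: sum_distrib_left fps_of_Cq_mult mult.assoc fps_of_Cq_commute[of _ "G _ _"] flip: num)
  then have "fps_of_Cq (fps_X - fps_const \<xi>) * W + fps_of_Cq (fps_const c) * Z = 0"
    by (simp add: Rnum W_def Z_def sum_distrib_left sum.distrib sum_subtractf distrib_right
        right_diff_distrib mult.assoc flip: add_diff_add)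
  then have *: "fps_of_Cq (fps_const c) * Z = - (fps_of_Cq (fps_X - fps_const \<xi>) * W)"
    by (simp add: eq_neg_iff_add_eq_0 add.commute)
  have F0: "fps_nth (F a b) p = 0" and G0: "fps_nth (G a b) p = 0" if "p > N" for a b p
    using that by (simp_all add: F_def G_def L1L2_degree L2L1_degree)
  \<comment> \<open>\<open>W\<close> has degree at most N + 1, as \<open>Rquo\<close> has degree at
    most 1 and \<open>F\<close>, \<open>G\<close> at most N. Multiplication by
    \<open>x - \<xi>\<close> raises this to N + 2, the cutoff that must be used throughout; it does
    not affect the values of \<open>F\<close> and \<open>G\<close>.\<close>
  have eval_FG: "fps_eval \<xi> (Suc (Suc N)) (F a b) = fps_eval \<xi> N (F a b)"
    "fps_eval \<xi> (Suc (Suc N)) (G a b) = fps_eval \<xi> N (G a b)" for a b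
    by (rule fps_eval_degree; simp add: F0 G0)+
  have "fps_nth W p = 0" if "p > Suc N" for p
    unfolding W_def fps_sum_nth fps_sub_nth using that
    by (intro sum.neutral ballI) (simp add: fps_mult_degree[OF _ F0, where m = 1]
        fps_mult_degree[OF _ G0, where m = 1] Rquo_degree of_Cq_0)
  from fps_eval_root[where W = W, OF this]
  have "fps_eval \<xi> (Suc (Suc N)) (fps_of_Cq (fps_const c) * Z) = 0"
    by (simp only: * fps_eval_def fps_neg_nth mult_minus_right sum_negf neg_equal_0_iff_equal)
  then have "of_Cq c * fps_eval \<xi> (Suc (Suc N)) Z = 0"
    by (simp only: fps_eval_const_mult)
  moreover have "c \<noteq> 0"
    using q_diff_neq_0 xi_neq_0 xi_neq_1[of "TYPE('n)"] by (simp add: c_def)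
  \<comment> \<open>The algebra may have zero divisors, but nonzero scalars are invertible in it.
    This serves to cancel \<open>c\<close>, and below the normalizing power of \<xi>.\<close>
  moreover have cancel: "x = y" if "of_Cq a * x = of_Cq a * y" "a \<noteq> 0"
    for a and x y :: "'g presented_algebra"
  proof -
    have "of_Cq (inverse a) * (of_Cq a * x) = of_Cq (inverse a) * (of_Cq a * y)" using that by simp
    then show ?thesis using that(2) by (simp add: of_Cq_mult of_Cq_1 flip: mult.assoc)
  qed
  ultimately have "fps_eval \<xi> (Suc (Suc N)) Z = 0"
    by (intro cancel[of c _ 0]) simp_all
  then have "(\<Sum>a\<in>UNIV. \<Sum>b\<in>UNIV. of_Cq (Qmat i a k b) * fps_eval \<xi> N (F a b))
      = (\<Sum>a\<in>UNIV. \<Sum>b\<in>UNIV. of_Cq (Qmat a j b l) * fps_eval \<xi> N (G a b))"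
    by (simp add: Z_def fps_eval_sum fps_eval_diff fps_eval_const_mult eval_FG sum_subtractf)
  moreover define y where "y = xi_norm TYPE('n) \<sigma> N"
  have "of_Cq (Qmat a b d e) * (of_Cq y * v) = of_Cq y * (of_Cq (Qmat a b d e) * v)"
    for a b d e :: "'n idx" and v :: "'g presented_algebra"
    by (metis of_Cq_commute mult.assoc)
  ultimately have "of_Cq y * fps_nth ?lhs N = of_Cq y * fps_nth ?rhs N"
    by (simp add: F_def G_def \<xi>_def eval_L1L2 eval_L2L1 A_def y_def fps_sum_nth fps_of_Cq_const
        sum_distrib_left)
  then show "fps_nth ?lhs N = fps_nth ?rhs N"
    by (rule cancel) (simp add: y_def xi_norm_neq_0)
qed

section \<open>The rank of Q\<close>

lemma Qmat_eq:
  "Qmat a b c d = (if a = c\<^sup>* \<and> b = d\<^sup>* then q powi (bar c - bar d) * of_int (eps c * eps d) else 0)"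
proof -
  have "Qmat a b c d = (\<Sum>i\<in>UNIV. \<Sum>j\<in>UNIV. if a = c\<^sup>* \<and> b = d\<^sup>* \<and> i = c \<and> j = d
      then q powi (bar c - bar d) * of_int (eps c * eps d) else 0)"
    unfolding Qmat_def by (intro sum.cong refl) (auto simp: E_def)
  then show ?thesis
    by (simp only: sum_UNIV_delta2)
qed

lemma num_dual_idx: "num ((i :: 'n::finite idx)\<^sup>*) = 2 * CARD('n) + 1 - num i"
  unfolding dual_idx_def using num[of i] by (subst mk_idx_inverse) auto

lemma dual_dual_idx [simp]: "((i :: 'n::finite idx)\<^sup>*)\<^sup>* = i"
  using num[of i] by (simp add: num_inject[symmetric] num_dual_idx)

lemma dual_idx_inject [simp]: "(i :: 'n::finite idx)\<^sup>* = j\<^sup>* \<longleftrightarrow> i = j"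
  by (metis dual_dual_idx)

lemma eps_dual_idx: "eps ((i :: 'n::finite idx)\<^sup>*) = - eps i"
  using num[of i] by (auto simp: eps_def num_dual_idx)

lemma eps_mult_eps: "eps i * eps i = 1"
  by (simp add: eps_def)

text \<open>\<open>Q\<close> is the product of the vector \<open>\<Sum> w\<^sub>i e\<^bsub>i'\<^esub> \<otimes> e\<^sub>i\<close> and the covector dual to it, where
  \<open>w\<^sub>i = q\<^bsup>bar i\<^esup> \<epsilon>\<^sub>i\<close>.\<close>
definition weight :: "'n::finite idx \<Rightarrow> 'g::presented presented_algebra fps"
  where "weight i = fps_of_Cq (fps_const (q powi bar i * of_int (eps i)))"

definition weight_inv :: "'n::finite idx \<Rightarrow> 'g::presented presented_algebra fps"
  where "weight_inv i = fps_of_Cq (fps_const (q powi (- bar i) * of_int (eps i)))"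

lemma weight_commute: "x * weight i = weight i * x" "x * weight_inv i = weight_inv i * x"
  by (simp_all add: weight_def weight_inv_def fps_of_Cq_commute)

lemma weight_mult_inv: "weight i * weight_inv i = 1"
proof -
  have "q powi bar i * of_int (eps i) * (q powi (- bar i) * of_int (eps i))
      = (q powi bar i * q powi (- bar i)) * of_int (eps i * eps i)"
    by (simp add: ac_simps)
  also have "\<dots> = 1" using q_neq_0 by (simp add: eps_mult_eps power_int_minus)
  finally show ?thesis
    by (simp add: weight_def weight_inv_def fps_of_Cq_1 flip: fps_of_Cq_mult)
qed

lemma fps_of_Cq_Qmat:
  "fps_of_Cq (fps_const (Qmat a b c d)) = (if a = c\<^sup>* \<and> b = d\<^sup>* then weight c * weight_inv d else 0)"
  using q_neq_0 by (simp add: Qmat_eq weight_def weight_inv_def fps_of_Cq_0 power_int_diff power_int_minus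
      field_simps flip: fps_of_Cq_mult)

text \<open>Conjugation by D supplies the powers of q and the transposition the signs, the two sign
  changes under duality cancelling. The resulting factor is exactly the one in the entries of
  Q.\<close>

lemma conj_tr_nth:
  fixes B :: "('n::finite, 'g::presented) smat"
  shows "(Dmat ** tr B ** Dinv) $ a $ b = weight a * weight_inv b * B $ (b\<^sup>*) $ (a\<^sup>*)"
proof -
  have delta: "(if a = c then x else 0) * y = (if c = a then x * y else 0)"
    "y * (if c = b then x else 0) = (if c = b then y * x else 0)" 
    for a b c :: "'n idx" and x y :: "'g presented_algebra fps"
    by auto
  let ?f = "\<lambda>c. fps_of_Cq (fps_const c)" and ?e = "of_int (eps a * eps b) :: Cq"
  have "(Dmat ** tr B ** Dinv) $ a $ b
      = fps_const (of_Cq (q powi bar a)) * tr B $ a $ b * fps_const (of_Cq (q powi - bar b))"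
    by (simp add: matrix_matrix_mult_def Dmat_def Dinv_def delta)
  also have "tr B $ a $ b = ?f ?e * B $ (b\<^sup>*) $ (a\<^sup>*)"
  proof -
    have "?f (- 1) = (- 1 :: 'g presented_algebra fps)"
      by (simp add: fps_eq_iff of_Cq_uminus of_Cq_1 of_Cq_0)
    moreover have "eps a = 1 \<or> eps a = - 1" "eps b = 1 \<or> eps b = - 1"
      by (simp_all add: eps_def)
    ultimately show ?thesis
      by (auto simp: tr_def eps_dual_idx fps_of_Cq_1)
  qed
  also have "fps_const (of_Cq (q powi bar a)) * (?f ?e * B $ (b\<^sup>*) $ (a\<^sup>*)) * fps_const (of_Cq (q powi - bar b))
      = ?f (q powi bar a * ?e * q powi - bar b) * B $ (b\<^sup>*) $ (a\<^sup>*)"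
    by (simp only: fps_of_Cq_const[symmetric] fps_const_mult[symmetric] fps_of_Cq_mult mult.assoc
        fps_of_Cq_commute[of "fps_const (q powi - bar b)"])
  also have "?f (q powi bar a * ?e * q powi - bar b) = weight a * weight_inv b"
    by (simp add: weight_def weight_inv_def ac_simps flip: fps_of_Cq_mult)
  finally show ?thesis .
qed

lemma conj_tr_mult_scalar:
  fixes S A :: "('n::finite, 'g::presented) smat"
  assumes "\<And>i j k l. (\<Sum>a\<in>UNIV. \<Sum>b\<in>UNIV. fps_of_Cq (fps_const (Qmat i a k b)) * (S $ a $ j * A $ b $ l))
    = (\<Sum>a\<in>UNIV. \<Sum>b\<in>UNIV. fps_of_Cq (fps_const (Qmat a j b l)) * (A $ k $ b * S $ i $ a))"
  shows "\<exists>z. Dmat ** tr S ** Dinv ** A = mat z \<and> A ** Dmat ** tr S ** Dinv = mat z"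
proof -
  define M where "M = Dmat ** tr S ** Dinv ** A"
  define M' where "M' = A ** (Dmat ** tr S ** Dinv)"
  have M: "M $ a $ d = (\<Sum>b\<in>UNIV. weight a * weight_inv b * (S $ (b\<^sup>*) $ (a\<^sup>*) * A $ b $ d))" for a d
    by (simp add: M_def matrix_matrix_mult_def[of "_ ** Dinv" A] conj_tr_nth mult.assoc)
  have M': "M' $ c $ d = (\<Sum>b\<in>UNIV. weight b * weight_inv d * (A $ c $ b * S $ (d\<^sup>*) $ (b\<^sup>*)))" for c d
    by (simp add: M'_def matrix_matrix_mult_def[of A "_ ** Dinv"] conj_tr_nth
        weight_commute[of "A $ _ $ _"] mult.assoc flip: mult.assoc[of "A $ _ $ _"])
  \<comment> \<open>As Q is a column times a row, one side is supported on
    \<open>i = k\<^sup>*\<close> and the other on \<open>j = l\<^sup>*\<close>. Where exactly one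
    condition holds, the nonzero candidate must vanish; this yields the off-diagonal entries of
    \<open>M\<close> and \<open>M'\<close>.\<close>
  have rank1: "(if i = k\<^sup>* then \<Sum>b\<in>UNIV. weight k * weight_inv b * (S $ (b\<^sup>*) $ j * A $ b $ l) else 0)
      = (if j = l\<^sup>* then \<Sum>b\<in>UNIV. weight b * weight_inv l * (A $ k $ b * S $ i $ (b\<^sup>*)) else 0)" for i j k l
  proof -
    have swap: "(\<Sum>a\<in>UNIV. \<Sum>b\<in>UNIV. if P \<and> a = b\<^sup>* then f a b else 0)
        = (if P then \<Sum>b\<in>UNIV. f (b\<^sup>*) b else 0)"
      for P and f :: "'n idx \<Rightarrow> 'n idx \<Rightarrow> 'g presented_algebra fps"
      by (subst sum.swap) (simp add: if_distrib cong: if_cong)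
    show ?thesis
      using assms[of i k j l]
      by (simp add: fps_of_Cq_Qmat if_distrib[of "\<lambda>x. x * _"] swap conj_commute[of _ "j = l\<^sup>*"] cong: if_cong)
  qed
  have off: "M $ a $ d = 0" "M' $ a $ d = 0" if "a \<noteq> d" for a d
    using rank1[of "a\<^sup>*" a "a\<^sup>*" d] rank1[of "d\<^sup>*" a "d\<^sup>*" d] that by (auto simp: M M')
  \<comment> \<open>Both conditions hold for \<open>i = k\<^sup>*\<close> and
    \<open>j = d\<^sup>*\<close> with \<open>l = d\<close>. Since d and k are independent, all
    diagonal entries of both matrices are one and the same series.\<close>
  have diag: "M $ d $ d = M' $ k $ k" for d k
  proof -
    define x where "x = (\<Sum>b\<in>UNIV. weight_inv b * (S $ (b\<^sup>*) $ (d\<^sup>*) * A $ b $ d))"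
    define y where "y = (\<Sum>b\<in>UNIV. weight b * (A $ k $ b * S $ (k\<^sup>*) $ (b\<^sup>*)))"
    have "weight k * x = weight_inv d * y"
      using rank1[of "k\<^sup>*" k "d\<^sup>*" d]
      by (simp add: x_def y_def sum_distrib_left mult.assoc weight_commute[of "weight _" d])
    have "M $ d $ d = weight d * (weight k * weight_inv k) * x"
      by (simp add: M x_def sum_distrib_left mult.assoc weight_mult_inv)
    also have "\<dots> = weight d * weight_inv k * (weight k * x)"
      by (simp add: mult.assoc weight_commute(2)[of "weight k" k])
    also have "\<dots> = weight d * weight_inv k * (weight_inv d * y)"
      by (simp only: \<open>weight k * x = weight_inv d * y\<close>)
    also have "\<dots> = (weight d * weight_inv d) * weight_inv k * y"
      by (simp add: mult.assoc weight_commute(2)[of "weight_inv k" d] flip: mult.assoc[of "weight_inv k"])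
    also have "\<dots> = M' $ k $ k"
      by (simp add: M' y_def weight_mult_inv sum_distrib_left mult.assoc weight_commute(2)[of "weight _" k])
    finally show ?thesis .
  qed
  obtain z where "M $ d $ d = z" "M' $ d $ d = z" for d
    using diag by metis
  with off have "M = mat z" "M' = mat z"
    by (auto simp: vec_eq_iff mat_def)
  then show ?thesis
    by (auto simp: M_def M'_def matrix_mul_assoc)
qed

theorem proposition3p3:
  shows "(\<forall>s::sign. \<exists>z :: 'n::finite UR fps.
      Dmat ** tr (subst_xi s (Lser (\<lambda>g. g) s)) ** Dinv ** Lser (\<lambda>g. g) s = mat z \<and>
      Lser (\<lambda>g. g) s ** Dmat ** tr (subst_xi s (Lser (\<lambda>g. g) s)) ** Dinv = mat z)
    \<and> (\<forall>s::sign. \<exists>z :: 'n URbar fps.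
      Dmat ** tr (subst_xi s (Lser Bar s)) ** Dinv ** Lser Bar s = mat z \<and>
      Lser Bar s ** Dmat ** tr (subst_xi s (Lser Bar s)) ** Dinv = mat z)"
proof (intro conjI allI)
  fix s :: sign
  have "RLL (\<lambda>g. g) Rmat 1 s s i j k l u v - LLR (\<lambda>g. g) Rmat 1 s s i j k l u v \<in> relators"
    for i j k l :: "'n idx" and u v
    unfolding relators_genR_def L_relators_def Let_def by blast
  \<comment> \<open>Here \<open>h\<close> is the inverse of g times the two denominators; for
    \<open>Rbar\<close> below it is the product of the denominators alone.\<close>
  from Q_subst_xi_L[OF this Rmat_numerator]
  show "\<exists>z :: 'n UR fps. Dmat ** tr (subst_xi s (Lser (\<lambda>g. g) s)) ** Dinv ** Lser (\<lambda>g. g) s = mat z \<and>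
      Lser (\<lambda>g. g) s ** Dmat ** tr (subst_xi s (Lser (\<lambda>g. g) s)) ** Dinv = mat z"
    by (rule conj_tr_mult_scalar)
next
  fix s :: sign
  have "RLL Bar Rbar 1 s s i j k l u v - LLR Bar Rbar 1 s s i j k l u v \<in> relators"
    for i j k l :: "'n idx" and u v
    unfolding relators_genRbar_def L_relators_def Let_def by blast
  from Q_subst_xi_L[OF this Rbar_numerator]
  show "\<exists>z :: 'n URbar fps. Dmat ** tr (subst_xi s (Lser Bar s)) ** Dinv ** Lser Bar s = mat z \<and>
      Lser Bar s ** Dmat ** tr (subst_xi s (Lser Bar s)) ** Dinv = mat z"
    by (rule conj_tr_mult_scalar)
qed

end
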